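(* Let $\mathfrak k$ be a field, $n\ge2$, and let $\Gamma=\mathfrak k\langle\langle x_1,\dots,x_n\rangle\rangle$ be the formal power series algebra in $n$ non-commuting variables. Then the Leavitt localization $L(\Gamma)$ of $\Gamma$ inverting universally the row $(x_1,\dots,x_n)$ is a simple algebra.
   Context: $L(\Gamma)$ is the $\mathfrak k$-algebra generated over $\Gamma$ by elements $x_1^*,\dots,x_n^*$ subject to the relations $x_i^*x_j=\delta_{ij}$ and $\sum_{i=1}^nx_ix_i^*=1$. Simple means that it has no two-sided ideals other than $0$ and itself. *)

theory Defs
  imports
    "HOL-Algebra.QuotRing"
    "HOL-Algebra.Algebraic_Closure_Type"
    "HOL-Library.Poly_Mapping"
    "HOL-Library.Cardinality"
begin

section \<open>Formal power series in non-commuting variables\<close>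

text \<open>
  The variables are indexed by \<open>'n\<close>; a series assigns a coefficient to every word in the variables.
\<close>

typedef ('n, 'k) ncfps = "UNIV :: ('n list \<Rightarrow> 'k) set"
  morphisms coeff Ncfps ..

setup_lifting type_definition_ncfps

lemma ncfps_eqI: "(\<And>w. coeff f w = coeff g w) \<Longrightarrow> f = g"
  by transfer auto

definition splits :: "'a list \<Rightarrow> ('a list \<times> 'a list) set"
  where "splits w = {(u, v). u @ v = w}"

lemma finite_splits [simp]: "finite (splits w)"
proof -
  have "splits w \<subseteq> (\<lambda>i. (take i w, drop i w)) ` {..length w}"
  proof
    fix p assume "p \<in> splits w"
    then show "p \<in> (\<lambda>i. (take i w, drop i w)) ` {..length w}"
      by (intro image_eqI[where x = "length (fst p)"]) (auto simp: splits_def)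
  qed
  then show ?thesis
    by (rule finite_subset) simp
qed

instantiation ncfps :: (type, ring_1) ring_1
begin

lift_definition zero_ncfps :: "('a, 'b) ncfps" is "\<lambda>_. 0" .

lift_definition one_ncfps :: "('a, 'b) ncfps" is "\<lambda>w. if w = [] then 1 else 0" .

lift_definition plus_ncfps :: "('a, 'b) ncfps \<Rightarrow> ('a, 'b) ncfps \<Rightarrow> ('a, 'b) ncfps"
  is "\<lambda>f g w. f w + g w" .

lift_definition minus_ncfps :: "('a, 'b) ncfps \<Rightarrow> ('a, 'b) ncfps \<Rightarrow> ('a, 'b) ncfps"
  is "\<lambda>f g w. f w - g w" .

lift_definition uminus_ncfps :: "('a, 'b) ncfps \<Rightarrow> ('a, 'b) ncfps"
  is "\<lambda>f w. - f w" .

lift_definition times_ncfps :: "('a, 'b) ncfps \<Rightarrow> ('a, 'b) ncfps \<Rightarrow> ('a, 'b) ncfps"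
  is "\<lambda>f g w. \<Sum>(u, v)\<in>splits w. f u * g v" .

instance
proof
  fix f g h :: "('a, 'b) ncfps"
  show "f * g * h = f * (g * h)"
  proof (transfer, rule ext)
    fix f g h :: "'a list \<Rightarrow> 'b" and w
    have "(\<Sum>(u, v)\<in>splits w. (\<Sum>(p, q)\<in>splits u. f p * g q) * h v) =
          (\<Sum>((u, v), (p, q))\<in>Sigma (splits w) (\<lambda>(u, v). splits u). f p * g q * h v)"
      by (simp add: sum_distrib_right case_prod_unfold sum.Sigma)
    also have "\<dots> =
          (\<Sum>((u, v), (p, q))\<in>Sigma (splits w) (\<lambda>(u, v). splits v). f u * (g p * h q))"
      by (rule sum.reindex_bij_witness[where
            i = "\<lambda>((u, v), (p, q)). ((u @ p, q), (u, p))" and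
            j = "\<lambda>((u, v), (p, q)). ((p, q @ v), (q, v))"])
         (auto simp: splits_def mult.assoc)
    also have "\<dots> = (\<Sum>(u, v)\<in>splits w. f u * (\<Sum>(p, q)\<in>splits v. g p * h q))"
      by (simp add: sum_distrib_left case_prod_unfold sum.Sigma)
    finally show "(\<Sum>(u, v)\<in>splits w. (\<Sum>(p, q)\<in>splits u. f p * g q) * h v) =
      (\<Sum>(u, v)\<in>splits w. f u * (\<Sum>(p, q)\<in>splits v. g p * h q))" .
  qed
  show "1 * f = f"
  proof (transfer, rule ext)
    fix f :: "'a list \<Rightarrow> 'b" and w
    have "(\<Sum>(u, v)\<in>splits w. (if u = [] then 1 else 0) * f v) = (\<Sum>(u :: 'a list, v)\<in>{([], w)}. f v)"
      by (rule sum.mono_neutral_cong_right[OF finite_splits]) (auto simp: splits_def split: if_splits)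
    then show "(\<Sum>(u, v)\<in>splits w. (if u = [] then 1 else 0) * f v) = f w"
      by simp
  qed
  show "f * 1 = f"
  proof (transfer, rule ext)
    fix f :: "'a list \<Rightarrow> 'b" and w
    have "(\<Sum>(u, v)\<in>splits w. f u * (if v = [] then 1 else 0)) = (\<Sum>(u, v :: 'a list)\<in>{(w, [])}. f u)"
      by (rule sum.mono_neutral_cong_right[OF finite_splits]) (auto simp: splits_def split: if_splits)
    then show "(\<Sum>(u, v)\<in>splits w. f u * (if v = [] then 1 else 0)) = f w"
      by simp
  qed
  show "(f + g) * h = f * h + g * h"
    by transfer (simp add: fun_eq_iff case_prod_unfold distrib_right sum.distrib)
  show "f * (g + h) = f * g + f * h"
    by transfer (simp add: fun_eq_iff case_prod_unfold distrib_left sum.distrib)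
  show "(0 :: ('a, 'b) ncfps) \<noteq> 1"
    by transfer (auto simp: fun_eq_iff)
qed (transfer; simp add: fun_eq_iff algebra_simps)+

end

lift_definition ncfps_const :: "'k \<Rightarrow> ('n, 'k::ring_1) ncfps"
  is "\<lambda>c w. if w = [] then c else 0" .

lift_definition ncfps_var :: "'n \<Rightarrow> ('n, 'k::ring_1) ncfps"
  is "\<lambda>i w. if w = [i] then 1 else 0" .


section \<open>Free algebras\<close>

datatype 'a free_monoid = Word "'a list"

instantiation free_monoid :: (type) monoid_add
begin

definition zero_free_monoid :: "'a free_monoid"
  where "0 = Word []"

fun plus_free_monoid :: "'a free_monoid \<Rightarrow> 'a free_monoid \<Rightarrow> 'a free_monoid"
  where "Word u + Word v = Word (u @ v)"

instance
proof
  fix a b c :: "'a free_monoid"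
  show "a + b + c = a + (b + c)"
    by (cases a; cases b; cases c) simp
  show "0 + a = a" "a + 0 = a"
    by (cases a; simp add: zero_free_monoid_def)+
qed

end

text \<open>
  The monoid being written additively, the convolution product of \<^theory>\<open>HOL-Library.Poly_Mapping\<close>
  makes the following type the free algebra over \<open>'k\<close> on the set of letters \<open>'a\<close>.
\<close>

type_synonym ('a, 'k) free_algebra = "'a free_monoid \<Rightarrow>\<^sub>0 'k"

definition letter :: "'a \<Rightarrow> ('a, 'k::ring_1) free_algebra"
  where "letter a = Poly_Mapping.single (Word [a]) 1"

definition scalar :: "'k \<Rightarrow> ('a, 'k::ring_1) free_algebra"
  where "scalar c = Poly_Mapping.single 0 c"


section \<open>The Leavitt localization\<close>

text \<open>
  The algebra generated over the power series algebra by the elements \<open>x\<^sub>i\<^sup>*\<close> is presented as a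
  \<open>'k\<close>-algebra with one generator for every power series and one for every \<open>x\<^sub>i\<^sup>*\<close>. The first three
  sets of relations say that the power series generators form an image of the power series algebra
  under a homomorphism of unital \<open>'k\<close>-algebras (the case \<open>c = 1\<close> of the third one gives
  unitality); the last two are the defining relations on the \<open>x\<^sub>i\<^sup>*\<close>.
\<close>

datatype ('n, 'k) leavitt_gen = Series "('n, 'k) ncfps" | Star 'n

abbreviation ser :: "('n, 'k::field) ncfps \<Rightarrow> (('n, 'k) leavitt_gen, 'k) free_algebra"
  where "ser f \<equiv> letter (Series f)"

abbreviation star :: "'n \<Rightarrow> (('n, 'k::field) leavitt_gen, 'k) free_algebra"
  where "star i \<equiv> letter (Star i)"

definition leavitt_relations :: "(('n::finite, 'k::field) leavitt_gen, 'k) free_algebra set"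
  where "leavitt_relations =
      {ser (f + g) - (ser f + ser g) | f g. True}
    \<union> {ser (f * g) - ser f * ser g | f g. True}
    \<union> {ser (ncfps_const c) - scalar c | c. True}
    \<union> {star i * ser (ncfps_var j) - (if i = j then 1 else 0) | i j. True}
    \<union> {(\<Sum>i\<in>UNIV. ser (ncfps_var i) * star i) - 1}"

definition leavitt :: "(('n::finite, 'k::field) leavitt_gen, 'k) free_algebra set ring"
  where "leavitt = ring_of_type_algebra Quot (Idl\<^bsub>ring_of_type_algebra\<^esub> leavitt_relations)"

text \<open>
  In a unital algebra the ring ideals are automatically closed under scalar multiplication, so
  simplicity as an algebra is simplicity as a ring. As usual the zero ring is not simple.
\<close>

definition simple_ring :: "('a, 'm) ring_scheme \<Rightarrow> bool"
  where "simple_ring R \<longleftrightarrow>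
    ring R \<and> carrier R \<noteq> {\<zero>\<^bsub>R\<^esub>} \<and> (\<forall>I. ideal I R \<longrightarrow> I = {\<zero>\<^bsub>R\<^esub>} \<or> I = carrier R)"

lemma ring_ring_of_type_algebra: "ring (ring_of_type_algebra :: 'a::ring_1 ring)"
proof -
  have "\<exists>y. y + x = 0 \<and> x + y = 0" for x :: 'a
    by (rule exI[of _ "- x"]) simp
  then show ?thesis
    unfolding ring_of_type_algebra_def
    by unfold_locales (auto simp: algebra_simps Units_def)
qed

lemma ring_leavitt:
  "ring (leavitt :: (('n::finite, 'k::field) leavitt_gen, 'k) free_algebra set ring)"
proof -
  interpret ring "ring_of_type_algebra :: (('n, 'k) leavitt_gen, 'k) free_algebra ring"
    by (rule ring_ring_of_type_algebra)
  have "leavitt_relations \<subseteq> carrier (ring_of_type_algebra :: (('n, 'k) leavitt_gen, 'k) free_algebra ring)"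
    by (simp add: ring_of_type_algebra_def)
  then show ?thesis
    unfolding leavitt_def by (intro ideal.quotient_is_ring genideal_ideal)
qed

end

theory Submission
  imports Defs
begin

text \<open>
  For simplicity, multiplying an element of the algebra on the right by a long enough monomial in the
  \<open>x\<^sub>i\<close> cancels all the stars, so a nonzero ideal contains the image of a nonzero power series;
  multiplying that on the left by suitable \<open>x\<^sub>i\<^sup>*\<close> turns it into a series with nonzero constant
  term, which is a unit.

  That the algebra is not zero is seen on the power series themselves, with series acting by
  multiplication and \<open>x\<^sub>i\<^sup>*\<close> acting by deleting a leading letter \<open>x\<^sub>i\<close>. The last relation
  only fails on the constant term, so all relations lie in the set of elements that annihilate every
  series of sufficiently large order, and this set is a proper two-sided ideal.
\<close>

section \<open>Power series\<close>

text \<open>The operator by which x_a^* will act on series: it undoes left multiplication by x_a and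
  kills constants and multiples of the other variables.\<close>

lift_definition left_quotient :: "'n \<Rightarrow> ('n, 'k::ring_1) ncfps \<Rightarrow> ('n, 'k) ncfps"
  is "\<lambda>a f w. f (a # w)" .

lemmas coeff_simps [simp] = zero_ncfps.rep_eq one_ncfps.rep_eq plus_ncfps.rep_eq minus_ncfps.rep_eq
  uminus_ncfps.rep_eq ncfps_const.rep_eq ncfps_var.rep_eq left_quotient.rep_eq

lemma coeff_sum [simp]: "coeff (\<Sum>a\<in>A. f a) w = (\<Sum>a\<in>A. coeff (f a) w)"
  by (induction A rule: infinite_finite_induct) auto

section \<open>Products of series, computed along the first letter\<close>

lemma splits_Nil [simp]: "splits [] = {([], [])}"
  by (auto simp: splits_def)

lemma splits_Cons: "splits (a # w) = insert ([], a # w) (map_prod (Cons a) id ` splits w)"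
proof
  show "splits (a # w) \<subseteq> insert ([], a # w) (map_prod (Cons a) id ` splits w)"
  proof
    fix p assume "p \<in> splits (a # w)"
    then show "p \<in> insert ([], a # w) (map_prod (Cons a) id ` splits w)"
      by (cases p; cases "fst p") (auto simp: splits_def map_prod_def image_iff)
  qed
qed (auto simp: splits_def)

lemma coeff_mult_Nil [simp]: "coeff (f * g) [] = coeff f [] * coeff g []"
  by (simp add: times_ncfps.rep_eq)

text \<open>A splitting of \<open>a # w\<close> has either an empty left part or one that begins
  with \<open>a\<close>. Only the left factor changes, so inductions on the word generalise over
  \<open>f\<close> and keep \<open>g\<close> fixed.\<close>

lemma coeff_mult_Cons:
  "coeff (f * g) (a # w) = coeff f [] * coeff g (a # w) + coeff (left_quotient a f * g) w"
proof -
  have "inj_on (map_prod (Cons a) id) (splits w)"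
    by (auto simp: inj_on_def)
  moreover have "([], a # w) \<notin> map_prod (Cons a) id ` splits w"
    by auto
  ultimately show ?thesis
    by (simp add: times_ncfps.rep_eq splits_Cons sum.reindex case_prod_unfold)
qed

lemma left_quotient_0 [simp]: "left_quotient a 0 = 0"
  by (rule ncfps_eqI) simp

lemma left_quotient_add: "left_quotient a (f + g) = left_quotient a f + left_quotient a g"
  by (rule ncfps_eqI) simp

lemma left_quotient_const [simp]: "left_quotient a (ncfps_const c) = 0"
  by (rule ncfps_eqI) simp

lemma left_quotient_var [simp]: "left_quotient a (ncfps_var b) = (if a = b then 1 else 0)"
  by (rule ncfps_eqI) auto

lemma coeff_const_mult [simp]: "coeff (ncfps_const c * f) w = c * coeff f w"
  by (cases w) (simp_all add: coeff_mult_Cons)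

lemma left_quotient_const_mult:
  "left_quotient a (ncfps_const c * f) = ncfps_const c * left_quotient a f"
  by (rule ncfps_eqI) simp

lemma const_mult_const: "ncfps_const c * ncfps_const d = ncfps_const (c * d)"
  by (rule ncfps_eqI) simp

lemma const_add: "ncfps_const (c + d) = ncfps_const c + ncfps_const d"
  by (rule ncfps_eqI) simp

lemma const_0 [simp]: "ncfps_const 0 = 0"
  by (rule ncfps_eqI) simp

lemma const_1 [simp]: "ncfps_const 1 = 1"
  by (rule ncfps_eqI) simp

lemma const_commute:
  fixes f :: "('n, 'k::comm_ring_1) ncfps"
  shows "f * ncfps_const c = ncfps_const c * f"
proof (rule ncfps_eqI)
  show "coeff (f * ncfps_const c) w = coeff (ncfps_const c * f) w" for w
    by (induction w arbitrary: f) (simp_all add: coeff_mult_Cons)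
qed

lemma left_quotient_var_mult: "left_quotient a (ncfps_var b * f) = (if a = b then f else 0)"
  by (rule ncfps_eqI) (simp add: coeff_mult_Cons)

text \<open>Every nonempty word has exactly one first letter, so only the constant term is lost.
  This loss is exactly how the relation on the sum of the x_i x_i^* fails for the action on
  series.\<close>

lemma sum_var_mult_left_quotient:
  fixes f :: "('n::finite, 'k::ring_1) ncfps"
  shows "(\<Sum>a\<in>UNIV. ncfps_var a * left_quotient a f) = f - ncfps_const (coeff f [])"
proof (rule ncfps_eqI)
  fix w :: "'n list"
  show "coeff (\<Sum>a\<in>UNIV. ncfps_var a * left_quotient a f) w = coeff (f - ncfps_const (coeff f [])) w"
  proof (cases w)
    case (Cons b v)
    have "coeff (left_quotient b (ncfps_var a) * left_quotient a f) v =
        (if b = a then coeff f (b # v) else 0)" for a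
      by simp
    \<comment> \<open>\<open>left_quotient_var\<close> is switched off so that the left-hand side of
      the fact survives and matches what \<open>coeff_mult_Cons\<close> produces.\<close>
    then show ?thesis
      using Cons by (simp add: coeff_mult_Cons del: left_quotient_var)
  qed simp
qed

text \<open>The second equation solves the vanishing of the coefficient of the product at
  \<open>a # w\<close> for the coefficient of the inverse there. The other terms involve the inverse
  only at suffixes of \<open>w\<close>, which are shorter than \<open>a # w\<close>.\<close>

function right_inverse_coeff :: "('n list \<Rightarrow> 'k::field) \<Rightarrow> 'n list \<Rightarrow> 'k" where
  "right_inverse_coeff f [] = inverse (f [])"
| "right_inverse_coeff f (a # w) =
    - inverse (f []) * (\<Sum>p\<in>splits w. f (a # fst p) * right_inverse_coeff f (snd p))"
  by pat_completeness auto
termination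
  by (relation "measure (length \<circ> snd)") (auto simp: splits_def)

text \<open>A right inverse is what the ideal argument calls for: a two-sided ideal containing
  \<open>f\<close> then contains \<open>f * g = 1\<close>.\<close>

lemma right_inverse_exists:
  fixes f :: "('n, 'k::field) ncfps"
  assumes "coeff f [] \<noteq> 0"
  obtains g where "f * g = 1"
proof
  define g where "g = Ncfps (right_inverse_coeff (coeff f))"
  have g: "coeff g w = right_inverse_coeff (coeff f) w" for w
    by (simp add: g_def Ncfps_inverse)
  show "f * g = 1"
  proof (rule ncfps_eqI)
    fix w
    show "coeff (f * g) w = coeff 1 w"
    proof (cases w)
      case (Cons a v)
      have "coeff (left_quotient a f * g) v =
          (\<Sum>p\<in>splits v. coeff f (a # fst p) * right_inverse_coeff (coeff f) (snd p))"
        by (simp add: times_ncfps.rep_eq g case_prod_unfold)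
      then show ?thesis
        using Cons assms by (simp add: coeff_mult_Cons g)
    qed (use assms g in simp)
  qed
qed

section \<open>The filtration of series by order\<close>

definition order_ge :: "nat \<Rightarrow> ('n, 'k::ring_1) ncfps \<Rightarrow> bool"
  where "order_ge N f \<longleftrightarrow> (\<forall>w. length w < N \<longrightarrow> coeff f w = 0)"

lemma order_ge_add: "order_ge N f \<Longrightarrow> order_ge N g \<Longrightarrow> order_ge N (f + g)"
  by (simp add: order_ge_def)

lemma order_ge_mult:
  assumes "order_ge N g"
  shows "order_ge N (f * g)"
proof -
  have "coeff (f * g) w = 0" if "length w < N" for w
    using that
  proof (induction w arbitrary: f)
    case Nil
    then show ?case using assms by (simp add: order_ge_def)
  next
    case (Cons a w)
    then show ?case using assms by (simp add: order_ge_def coeff_mult_Cons)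
  qed
  then show ?thesis by (simp add: order_ge_def)
qed

lemma order_ge_left_quotient: "order_ge (Suc N) f \<Longrightarrow> order_ge N (left_quotient a f)"
  by (simp add: order_ge_def)

lemma order_ge_mono: "order_ge N f \<Longrightarrow> M \<le> N \<Longrightarrow> order_ge M f"
  by (auto simp: order_ge_def)

lemma exists_order_ge_nonzero: "\<exists>f :: ('n, 'k::ring_1) ncfps. order_ge N f \<and> f \<noteq> 0"
proof
  let ?f = "Ncfps (\<lambda>w. if length w = N then 1 else 0) :: ('n, 'k) ncfps"
  \<comment> \<open>\<open>undefined\<close> stands for an arbitrary letter, since every word of
    length \<open>N\<close> has coefficient 1.\<close>
  have "coeff ?f (replicate N undefined) \<noteq> 0"
    by (simp add: Ncfps_inverse)
  then have "?f \<noteq> 0"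
    by (metis zero_ncfps.rep_eq)
  then show "order_ge N ?f \<and> ?f \<noteq> 0"
    by (simp add: order_ge_def Ncfps_inverse)
qed


section \<open>The free algebra\<close>

lemma poly_mapping_single_add_induct [case_names single add]:
  assumes single: "\<And>k c. P (Poly_Mapping.single k c)"
    and add: "\<And>p q. P p \<Longrightarrow> P q \<Longrightarrow> P (p + q)"
  shows "P p"
proof (induction p rule: update_induct)
  case const
  show ?case using single[of undefined 0] by simp
next
  case (update p k c)
  \<comment> \<open>The key \<open>k\<close> is new to \<open>p\<close>, so overwriting its value
    amounts to adding a single term.\<close>
  have "Poly_Mapping.update k c p = p + Poly_Mapping.single k c"
    using update by (intro poly_mapping_eqI)
      (auto simp: lookup_update lookup_add lookup_single when_def in_keys_iff)
  then show ?case using add[OF update(3) single] by simp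
qed

text \<open>A monomial arises from its coefficient by multiplying letters on from the left, last
  letter first. This is the order in which the letters act on a left module.\<close>

lemma free_algebra_induct [case_names scalar letter add]:
  fixes p :: "('a, 'k::ring_1) free_algebra"
  assumes scalar: "\<And>c. P (scalar c)"
    and letter: "\<And>a p. P p \<Longrightarrow> P (letter a * p)"
    and add: "\<And>p q. P p \<Longrightarrow> P q \<Longrightarrow> P (p + q)"
  shows "P p"
proof (induction p rule: poly_mapping_single_add_induct)
  case (single k c)
  have "P (Poly_Mapping.single (Word u) c)" for u
  proof (induction u)
    case Nil
    then show ?case using scalar[of c] by (simp add: scalar_def zero_free_monoid_def)
  next
    case (Cons a u)
    have "Poly_Mapping.single (Word (a # u)) c = letter a * Poly_Mapping.single (Word u) c"
      by (simp add: letter_def mult_single)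
    then show ?case using letter[OF Cons, of a] by simp
  qed
  then show ?case by (cases k) simp
qed (rule add)

lemma scalar_0 [simp]: "scalar 0 = 0"
  by (simp add: scalar_def)

lemma scalar_1 [simp]: "scalar 1 = 1"
  by (simp add: scalar_def)


section \<open>The action on power series\<close>

fun act_gen :: "('n, 'k::field) leavitt_gen \<Rightarrow> ('n, 'k) ncfps \<Rightarrow> ('n, 'k) ncfps" where
  "act_gen (Series f) g = f * g"
| "act_gen (Star a) g = left_quotient a g"

text \<open>\<open>foldr\<close> lets the last letter act first, so concatenation of words becomes
  composition and the free algebra acts from the left.\<close>

fun act_word :: "('n, 'k::field) leavitt_gen free_monoid \<Rightarrow> ('n, 'k) ncfps \<Rightarrow> ('n, 'k) ncfps" where
  "act_word (Word u) g = foldr act_gen u g"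

definition act :: "(('n, 'k::field) leavitt_gen, 'k) free_algebra \<Rightarrow> ('n, 'k) ncfps \<Rightarrow> ('n, 'k) ncfps"
  where "act p g = (\<Sum>u\<in>Poly_Mapping.keys p. ncfps_const (Poly_Mapping.lookup p u) * act_word u g)"

lemma act_gen_0 [simp]: "act_gen a 0 = 0"
  by (cases a) auto

lemma act_gen_add: "act_gen a (f + g) = act_gen a f + act_gen a g"
  by (cases a) (auto simp: left_quotient_add distrib_left)

lemma act_gen_const_mult: "act_gen a (ncfps_const c * g) = ncfps_const c * act_gen a g"
proof (cases a)
  case (Series f)
  then show ?thesis
    by simp (metis const_commute mult.assoc)
qed (simp add: left_quotient_const_mult)

lemma act_single: "act (Poly_Mapping.single u c) g = ncfps_const c * act_word u g"
  by (simp add: act_def)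

text \<open>Cancellation may shrink the support of a sum; a common larger index set makes additivity
  a termwise matter.\<close>

lemma act_superset:
  assumes "Poly_Mapping.keys p \<subseteq> A" "finite A"
  shows "act p g = (\<Sum>u\<in>A. ncfps_const (Poly_Mapping.lookup p u) * act_word u g)"
  unfolding act_def using assms
  by (intro sum.mono_neutral_left) (auto simp: in_keys_iff)

lemma act_add: "act (p + q) g = act p g + act q g"
proof -
  let ?A = "Poly_Mapping.keys p \<union> Poly_Mapping.keys q"
  have "act (p + q) g = (\<Sum>u\<in>?A. ncfps_const (Poly_Mapping.lookup (p + q) u) * act_word u g)"
    by (rule act_superset) (auto simp: Poly_Mapping.keys_add)
  also have "\<dots> = act p g + act q g"
    by (simp add: act_superset[of p ?A] act_superset[of q ?A] lookup_add const_add distrib_right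
        sum.distrib)
  finally show ?thesis .
qed

lemma act_diff: "act (p - q) g = act p g - act q g"
  using act_add[of "p - q" q g] by (simp add: algebra_simps)

lemma act_0 [simp]: "act 0 g = 0"
  by (simp add: act_def)

lemma act_sum: "act (\<Sum>a\<in>A. p a) g = (\<Sum>a\<in>A. act (p a) g)"
  by (induction A rule: infinite_finite_induct) (auto simp: act_add)

lemma act_scalar [simp]: "act (scalar c) g = ncfps_const c * g"
  by (simp add: scalar_def act_single zero_free_monoid_def)

lemma act_1 [simp]: "act 1 g = g"
  using act_scalar[of 1 g] by simp

lemma act_letter [simp]: "act (letter a) g = act_gen a g"
  by (simp add: letter_def act_single)

lemma act_scalar_mult: "act (scalar c * p) g = ncfps_const c * act p g"
proof (induction p rule: poly_mapping_single_add_induct)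
  case (single u d)
  then show ?case
    by (simp add: scalar_def mult_single act_single const_mult_const flip: mult.assoc)
qed (simp add: distrib_left act_add)

lemma act_letter_mult: "act (letter a * p) g = act_gen a (act p g)"
proof (induction p rule: poly_mapping_single_add_induct)
  case (single u d)
  then show ?case
    by (cases u) (simp add: letter_def mult_single act_single act_gen_const_mult)
qed (simp add: distrib_left act_add act_gen_add)

lemma act_mult: "act (p * q) g = act p (act q g)"
proof (induction p arbitrary: q rule: free_algebra_induct)
  case (letter a p)
  then show ?case by (simp add: act_letter_mult mult.assoc)
qed (simp_all add: act_scalar_mult act_add distrib_right)

lemma act_zero_right [simp]: "act p 0 = 0"
  by (induction p rule: free_algebra_induct) (simp_all add: act_letter_mult act_add)

text \<open>Continuity of the action: series do not lower the order and a star lowers it by at most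
  one, so a bound depending only on \<open>p\<close> and \<open>N\<close> exists.\<close>

lemma order_ge_act: "\<exists>M. \<forall>g. order_ge M g \<longrightarrow> order_ge N (act p g)"
proof (induction p arbitrary: N rule: free_algebra_induct)
  case (scalar c)
  then show ?case by (auto intro!: exI[of _ N] order_ge_mult)
next
  case (letter a p)
  \<comment> \<open>\<open>Suc N\<close> leaves room for the one degree that a star may
    remove.\<close>
  obtain M where M: "order_ge (Suc N) (act p g)" if "order_ge M g" for g
    using letter[of "Suc N"] by blast
  have "order_ge N (act_gen a f)" if "order_ge (Suc N) f" for f
    using that by (cases a) (auto intro: order_ge_mult order_ge_left_quotient order_ge_mono)
  then show ?case using M by (auto simp: act_letter_mult)
next
  case (add p q)
  obtain K M where "\<And>g. order_ge K g \<Longrightarrow> order_ge N (act p g)"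
    and "\<And>g. order_ge M g \<Longrightarrow> order_ge N (act q g)"
    using add[of N] by blast
  then have "order_ge (max K M) g \<longrightarrow> order_ge N (act (p + q) g)" for g
    by (metis act_add max.cobounded1 max.cobounded2 order_ge_add order_ge_mono)
  then show ?case by blast
qed

text \<open>Annihilating every series would be too strong: the sum of the x_i x_i^* minus 1 sends a
  series to minus its constant term. The bound \<open>N\<close> may vary with \<open>p\<close>,
  since right multiplication by stars can raise it.\<close>

definition high_order_annihilator :: "(('n, 'k::field) leavitt_gen, 'k) free_algebra set"
  where "high_order_annihilator = {p. \<exists>N. \<forall>g. order_ge N g \<longrightarrow> act p g = 0}"

lemma one_notin_high_order_annihilator: "1 \<notin> high_order_annihilator"
  using exists_order_ge_nonzero by (fastforce simp: high_order_annihilator_def)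

lemma leavitt_relations_high_order_annihilator:
  "(leavitt_relations :: (('n::finite, 'k::field) leavitt_gen, 'k) free_algebra set)
    \<subseteq> high_order_annihilator"
proof
  fix r :: "(('n, 'k) leavitt_gen, 'k) free_algebra"
  assume "r \<in> leavitt_relations"
  \<comment> \<open>The bound 1 means a zero constant term, as the last relation requires; the
    others act as zero on every series.\<close>
  then have "act r g = 0" if "order_ge 1 g" for g
    using that
    by (auto simp: leavitt_relations_def act_diff act_add act_mult act_sum order_ge_def
        left_quotient_var_mult sum_var_mult_left_quotient distrib_right mult.assoc)
  then show "r \<in> high_order_annihilator"
    by (auto simp: high_order_annihilator_def)
qed


section \<open>Ideals of the free algebra\<close>

lemma ring_of_type_algebra_simps [simp]:
  "carrier ring_of_type_algebra = UNIV"
  "x \<otimes>\<^bsub>ring_of_type_algebra\<^esub> y = x * y"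
  "x \<oplus>\<^bsub>ring_of_type_algebra\<^esub> y = x + y"
  "\<one>\<^bsub>ring_of_type_algebra\<^esub> = 1"
  "\<zero>\<^bsub>ring_of_type_algebra\<^esub> = 0"
  by (simp_all add: ring_of_type_algebra_def)

lemma ideal_ring_of_type_algebraI:
  fixes J :: "'a::ring_1 set"
  assumes zero: "0 \<in> J" and add: "\<And>x y. x \<in> J \<Longrightarrow> y \<in> J \<Longrightarrow> x + y \<in> J"
    and left: "\<And>r x. x \<in> J \<Longrightarrow> r * x \<in> J" and right: "\<And>r x. x \<in> J \<Longrightarrow> x * r \<in> J"
  shows "ideal J ring_of_type_algebra"
proof -
  interpret R: ring "ring_of_type_algebra :: 'a ring" by (rule ring_ring_of_type_algebra)
  have "\<ominus>\<^bsub>ring_of_type_algebra\<^esub> x = - x" for x :: 'a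
    by (rule R.minus_equality) simp_all
  moreover have "- x \<in> J" if "x \<in> J" for x
    using left[OF that, of "- 1"] by simp
  ultimately have "subgroup J (add_monoid (ring_of_type_algebra :: 'a ring))"
    using zero add by (intro R.add.subgroupI) (auto simp flip: a_inv_def)
  then show ?thesis
    using left right by (intro idealI) (auto simp: ring_ring_of_type_algebra)
qed

section \<open>Congruence modulo an ideal\<close>

context
  fixes J :: "'a::ring_1 set"
  assumes J: "ideal J ring_of_type_algebra"
begin

interpretation J: ideal J ring_of_type_algebra by (rule J)

lemma ideal_add: "x \<in> J \<Longrightarrow> y \<in> J \<Longrightarrow> x + y \<in> J"
  using additive_subgroup.a_closed[OF J.additive_subgroup_axioms] by simp

lemma ideal_mult_left: "x \<in> J \<Longrightarrow> r * x \<in> J"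
  using J.I_l_closed by simp

lemma ideal_mult_right: "x \<in> J \<Longrightarrow> x * r \<in> J"
  using J.I_r_closed by simp

lemma ideal_zero: "0 \<in> J"
  using additive_subgroup.zero_closed[OF J.additive_subgroup_axioms] by simp

lemma ideal_diff: "x \<in> J \<Longrightarrow> y \<in> J \<Longrightarrow> x - y \<in> J"
  using ideal_add[of x "- 1 * y"] ideal_mult_left[of y "- 1"] by simp

lemma ideal_sum: "(\<And>a. a \<in> A \<Longrightarrow> f a \<in> J) \<Longrightarrow> (\<Sum>a\<in>A. f a) \<in> J"
  by (induction A rule: infinite_finite_induct) (auto intro: ideal_zero ideal_add)

text \<open>Membership of \<open>x - y\<close> plays the role of equality in the quotient, so
  computations stay among representatives in the free algebra.\<close>

lemma ideal_cong: "x - y \<in> J \<Longrightarrow> x \<in> J \<longleftrightarrow> y \<in> J"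
  using ideal_add[of "x - y" y] ideal_diff[of x "x - y"] by auto

lemma ideal_diff_trans: "x - y \<in> J \<Longrightarrow> y - z \<in> J \<Longrightarrow> x - z \<in> J"
  using ideal_add[of "x - y" "y - z"] by simp

end

lemma ideal_high_order_annihilator: "ideal high_order_annihilator ring_of_type_algebra"
proof (rule ideal_ring_of_type_algebraI)
  fix p q :: "(('a, 'b) leavitt_gen, 'b) free_algebra"
  assume p: "p \<in> high_order_annihilator"
  then obtain N where N: "act p g = 0" if "order_ge N g" for g
    by (auto simp: high_order_annihilator_def)
  show "q * p \<in> high_order_annihilator"
    using N by (auto simp: high_order_annihilator_def act_mult intro!: exI[of _ N])
  \<comment> \<open>By continuity \<open>q\<close> sends series of large enough order to series of
    order at least \<open>N\<close>, where \<open>p\<close> vanishes.\<close>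
  show "p * q \<in> high_order_annihilator"
    using order_ge_act[of N q] N by (auto simp: high_order_annihilator_def act_mult)
  assume "q \<in> high_order_annihilator"
  then obtain M where M: "act q g = 0" if "order_ge M g" for g
    by (auto simp: high_order_annihilator_def)
  have "act (p + q) g = 0" if "order_ge (max N M) g" for g
    using N M that by (metis act_add add_0 max.cobounded1 max.cobounded2 order_ge_mono)
  then show "p + q \<in> high_order_annihilator"
    by (auto simp: high_order_annihilator_def)
qed (simp add: high_order_annihilator_def)


section \<open>Ideals containing the Leavitt relations\<close>

definition monomial :: "'n list \<Rightarrow> ('n, 'k::ring_1) ncfps"
  where "monomial w = prod_list (map ncfps_var w)"

lemma monomial_Nil [simp]: "monomial [] = 1"
  by (simp add: monomial_def)

lemma monomial_snoc: "monomial (w @ [a]) = monomial w * ncfps_var a"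
  by (simp add: monomial_def)

text \<open>The ideal is left open so that the results hold both for the ideal generated by the
  relations and for larger ideals; simplicity comes from comparing the two.\<close>

locale leavitt_ideal =
  fixes J :: "(('n::finite, 'k::field) leavitt_gen, 'k) free_algebra set"
  assumes ideal: "ideal J ring_of_type_algebra"
    and relations: "leavitt_relations \<subseteq> J"
begin

section \<open>The defining relations as congruences\<close>

lemma ser_add: "ser (f + g) - (ser f + ser g) \<in> J"
  and ser_mult: "ser (f * g) - ser f * ser g \<in> J"
  and ser_const: "ser (ncfps_const c) - scalar c \<in> J"
  and star_ser_var: "star a * ser (ncfps_var b) - (if a = b then 1 else 0) \<in> J"
  and sum_var_star: "(\<Sum>a\<in>UNIV. ser (ncfps_var a) * star a) - 1 \<in> J"
  using relations unfolding leavitt_relations_def Un_subset_iff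
  by (simp_all only: subset_iff mem_Collect_eq insert_iff) metis+

lemma ser_0: "ser 0 \<in> J"
  using ser_const[of 0] by simp

lemma ser_1: "ser 1 - 1 \<in> J"
  using ser_const[of 1] by simp

lemma ser_mult': "ser f * ser g - ser (f * g) \<in> J"
  using ideal_diff[OF ideal ideal_zero[OF ideal] ser_mult[of f g]] by simp

lemma ser_sum: "finite A \<Longrightarrow> ser (\<Sum>a\<in>A. f a) - (\<Sum>a\<in>A. ser (f a)) \<in> J"
proof (induction A rule: finite_induct)
  case (insert b A)
  have "ser (f b + (\<Sum>a\<in>A. f a)) - (ser (f b) + ser (\<Sum>a\<in>A. f a))
      + (ser (\<Sum>a\<in>A. f a) - (\<Sum>a\<in>A. ser (f a))) \<in> J"
    using insert ser_add by (intro ideal_add[OF ideal])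
  then show ?case using insert by (simp add: algebra_simps)
qed (simp add: ser_0)

text \<open>Write \<open>f\<close> as the sum of the x_b f_b, where f_b is its left quotient by b;
  then x_a^* picks out f_a. A constant term c would leave a further summand c x_a^*.\<close>

lemma star_ser:
  assumes "coeff f [] = 0"
  shows "star a * ser f - ser (left_quotient a f) \<in> J"
proof -
  let ?d = "\<lambda>b. left_quotient b f"
  have f: "f = (\<Sum>b\<in>UNIV. ncfps_var b * ?d b)"
    using assms by (simp add: sum_var_mult_left_quotient)
  have 1: "star a * ser f - star a * (\<Sum>b\<in>UNIV. ser (ncfps_var b * ?d b)) \<in> J"
    using ideal_mult_left[OF ideal ser_sum[of UNIV "\<lambda>b. ncfps_var b * ?d b"], of "star a"]
    by (simp add: right_diff_distrib flip: f)
  have 2: "star a * ser (ncfps_var b * ?d b) - (if a = b then 1 else 0) * ser (?d b) \<in> J" for b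
  proof (rule ideal_diff_trans[OF ideal])
    show "star a * ser (ncfps_var b * ?d b) - star a * (ser (ncfps_var b) * ser (?d b)) \<in> J"
      unfolding right_diff_distrib[symmetric] by (rule ideal_mult_left[OF ideal ser_mult])
    show "star a * (ser (ncfps_var b) * ser (?d b)) - (if a = b then 1 else 0) * ser (?d b) \<in> J"
      unfolding mult.assoc[symmetric] left_diff_distrib[symmetric]
      by (rule ideal_mult_right[OF ideal star_ser_var])
  qed
  have "star a * (\<Sum>b\<in>UNIV. ser (ncfps_var b * ?d b)) - (\<Sum>b\<in>UNIV. (if a = b then 1 else 0) * ser (?d b)) \<in> J"
    unfolding sum_distrib_left sum_subtractf[symmetric] by (intro ideal_sum[OF ideal] 2)
  also have "(\<Sum>b\<in>UNIV. (if a = b then 1 else 0) * ser (?d b)) = ser (?d a)"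
    by (simp add: if_distrib[of "\<lambda>x. x * _"] cong: if_cong)
  finally show ?thesis
    using 1 by (rule ideal_diff_trans[OF ideal, rotated])
qed

lemma mult_monomial_series:
  "\<exists>m. \<forall>w. length w \<ge> m \<longrightarrow> (\<exists>f. p * ser (monomial w) - ser f \<in> J)"
proof (induction p rule: free_algebra_induct)
  case (scalar c)
  have "scalar c * ser (monomial w) - ser (ncfps_const c * monomial w) \<in> J" for w
  proof -
    have "scalar c * ser (monomial w) - ser (ncfps_const c) * ser (monomial w) \<in> J"
      using ideal_mult_right[OF ideal ideal_diff[OF ideal ideal_zero[OF ideal] ser_const[of c]], of "ser (monomial w)"]
      by (simp add: left_diff_distrib)
    then show ?thesis by (rule ideal_diff_trans[OF ideal _ ser_mult'])
  qed
  then show ?case by blast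
next
  case (letter a p)
  then obtain m where m: "\<exists>f. p * ser (monomial w) - ser f \<in> J" if "length w \<ge> m" for w
    by blast
  have "\<exists>g. letter a * p * ser (monomial w) - ser g \<in> J" if w: "length w \<ge> Suc m" for w
  proof (cases a)
    case (Series h)
    obtain f where f: "p * ser (monomial w) - ser f \<in> J"
      using m[of w] w by auto
    have "letter a * p * ser (monomial w) - ser h * ser f \<in> J"
      using ideal_mult_left[OF ideal f, of "ser h"] Series
      by (simp add: right_diff_distrib mult.assoc)
    then show ?thesis
      using ideal_diff_trans[OF ideal _ ser_mult'] by blast
  next
    case (Star b)
    \<comment> \<open>The last letter is held back: right multiplication by x_c removes the constant
      term of the series \<open>f\<close> obtained for \<open>v\<close>, as \<open>star_ser\<close>
      demands.\<close>
    obtain v c where v: "w = v @ [c]"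
      using w by (cases w rule: rev_cases) auto
    obtain f where f: "p * ser (monomial v) - ser f \<in> J"
      using m[of v] w v by auto
    let ?x = "ser (ncfps_var c)"
    have "p * ser (monomial w) - p * (ser (monomial v) * ?x) \<in> J"
      unfolding right_diff_distrib[symmetric] v monomial_snoc by (rule ideal_mult_left[OF ideal ser_mult])
    moreover have "p * (ser (monomial v) * ?x) - ser f * ?x \<in> J"
      unfolding mult.assoc[symmetric] left_diff_distrib[symmetric]
      by (rule ideal_mult_right[OF ideal f])
    ultimately have "p * ser (monomial w) - ser (f * ncfps_var c) \<in> J"
      using ideal_diff_trans[OF ideal] ser_mult' by blast
    then have "star b * (p * ser (monomial w)) - star b * ser (f * ncfps_var c) \<in> J"
      unfolding right_diff_distrib[symmetric] by (rule ideal_mult_left[OF ideal])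
    moreover have "star b * ser (f * ncfps_var c) - ser (left_quotient b (f * ncfps_var c)) \<in> J"
      by (rule star_ser) simp
    ultimately have "star b * (p * ser (monomial w)) - ser (left_quotient b (f * ncfps_var c)) \<in> J"
      by (rule ideal_diff_trans[OF ideal])
    then show ?thesis
      unfolding Star mult.assoc ..
  qed
  then show ?case by blast
next
  case (add p q)
  then obtain m n where m: "\<And>w. length w \<ge> m \<Longrightarrow> \<exists>f. p * ser (monomial w) - ser f \<in> J"
    and n: "\<And>w. length w \<ge> n \<Longrightarrow> \<exists>f. q * ser (monomial w) - ser f \<in> J"
    by blast
  have "\<exists>h. (p + q) * ser (monomial w) - ser h \<in> J" if w: "length w \<ge> max m n" for w
  proof -
    obtain f g where fg: "p * ser (monomial w) - ser f \<in> J" "q * ser (monomial w) - ser g \<in> J"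
      using m[of w] n[of w] w by auto
    have "(p * ser (monomial w) - ser f) + (q * ser (monomial w) - ser g)
        - (ser (f + g) - (ser f + ser g)) \<in> J"
      by (intro ideal_diff[OF ideal] ideal_add[OF ideal] fg ser_add)
    then have "(p + q) * ser (monomial w) - ser (f + g) \<in> J"
      by (simp add: algebra_simps)
    then show ?thesis ..
  qed
  then show ?case by blast
qed

text \<open>If q x_a were in \<open>J\<close> for every a, then so would be q, which is congruent to
  the sum of the q x_a x_a^*. Hence a letter can always be appended without falling into
  \<open>J\<close>.\<close>

lemma mult_monomial_notin:
  assumes "p \<notin> J"
  shows "\<exists>w. length w = m \<and> p * ser (monomial w) \<notin> J"
proof (induction m)
  case 0
  have "p * ser 1 - p \<in> J"
    using ideal_mult_left[OF ideal ser_1, of p] by (simp add: right_diff_distrib)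
  then have "p * ser 1 \<notin> J"
    using ideal_cong[OF ideal] assms by blast
  then show ?case by simp
next
  case (Suc m)
  then obtain w where w: "length w = m" "p * ser (monomial w) \<notin> J" by blast
  let ?q = "p * ser (monomial w)"
  have "\<exists>a. ?q * ser (ncfps_var a) \<notin> J"
  proof (rule ccontr)
    assume "\<nexists>a. ?q * ser (ncfps_var a) \<notin> J"
    then have "(\<Sum>a\<in>UNIV. ?q * ser (ncfps_var a) * star a) \<in> J"
      by (intro ideal_sum[OF ideal]) (metis ideal_mult_right[OF ideal])
    moreover have "(\<Sum>a\<in>UNIV. ?q * ser (ncfps_var a) * star a) - ?q \<in> J"
      using ideal_mult_left[OF ideal sum_var_star, of ?q]
      by (simp add: right_diff_distrib sum_distrib_left mult.assoc)
    ultimately show False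
      using ideal_cong[OF ideal] w by blast
  qed
  then obtain a where a: "?q * ser (ncfps_var a) \<notin> J" by blast
  have "p * ser (monomial (w @ [a])) - ?q * ser (ncfps_var a) \<in> J"
    unfolding monomial_snoc mult.assoc right_diff_distrib[symmetric]
    by (rule ideal_mult_left[OF ideal ser_mult])
  then have "p * ser (monomial (w @ [a])) \<notin> J"
    using ideal_cong[OF ideal] a by blast
  then show ?case using w by (intro exI[of _ "w @ [a]"]) simp
qed

section \<open>Nonzero series generate the unit ideal\<close>

lemma one_in_if_unit_in:
  assumes "ser f \<in> J" "coeff f [] \<noteq> 0"
  shows "1 \<in> J"
proof -
  obtain g where g: "f * g = 1"
    using right_inverse_exists[OF assms(2)] .
  have "ser f * ser g \<in> J"
    by (rule ideal_mult_right[OF ideal assms(1)])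
  then have "ser 1 \<in> J"
    using ser_mult[of f g] ideal_cong[OF ideal] unfolding g by blast
  then show ?thesis
    using ser_1 ideal_cong[OF ideal] by blast
qed

text \<open>Left multiplication by stars moves the coefficient at \<open>w\<close> to the constant
  term, one letter at a time. A nonzero constant term met on the way ends the process early:
  \<open>star_ser\<close> no longer applies, but the series already has a right inverse.\<close>

lemma one_in_if_series_in:
  assumes "ser f \<in> J" "coeff f w \<noteq> 0"
  shows "1 \<in> J"
  using assms
proof (induction w arbitrary: f)
  case Nil
  then show ?case by (rule one_in_if_unit_in)
next
  case (Cons a w)
  show ?case
  proof (cases "coeff f [] = 0")
    case True
    have "ser (left_quotient a f) \<in> J"
      using star_ser[OF True, of a] ideal_mult_left[OF ideal Cons.prems(1), of "star a"]
        ideal_cong[OF ideal] by blast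
    then show ?thesis
      using Cons.IH[of "left_quotient a f"] Cons.prems(2) by simp
  next
    case False
    then show ?thesis using Cons.prems(1) one_in_if_unit_in by blast
  qed
qed

text \<open>Both ideals enter: \<open>p\<close> being outside \<open>J\<close> keeps the resulting
  series nonzero, while \<open>p\<close> being in \<open>K\<close> puts that series into
  \<open>K\<close>.\<close>

lemma one_in_larger_ideal:
  assumes K: "ideal K ring_of_type_algebra" "J \<subseteq> K" and p: "p \<in> K" "p \<notin> J"
  shows "1 \<in> K"
proof -
  interpret K: leavitt_ideal K
    using K relations by (intro leavitt_ideal.intro) auto
  obtain m where m: "\<And>w. length w \<ge> m \<Longrightarrow> \<exists>f. p * ser (monomial w) - ser f \<in> J"
    using mult_monomial_series by blast
  obtain w where w: "length w = m" "p * ser (monomial w) \<notin> J"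
    using mult_monomial_notin[OF p(2)] by blast
  obtain f where f: "p * ser (monomial w) - ser f \<in> J"
    using m w by blast
  have "ser f \<notin> J"
    using f w ideal_cong[OF ideal] by blast
  then have "f \<noteq> 0"
    using ser_0 by blast
  then obtain v where v: "coeff f v \<noteq> 0"
    using ncfps_eqI[of f 0] by auto
  have "p * ser (monomial w) \<in> K"
    using p ideal_mult_right[OF K(1)] by blast
  then have "ser f \<in> K"
    using f K ideal_cong[OF K(1)] by blast
  then show ?thesis
    using v K.one_in_if_series_in by blast
qed

end

section \<open>Simplicity of a quotient ring\<close>

lemma simple_ring_quotient:
  fixes R :: "('a, 'm) ring_scheme"
  assumes "ideal J R" and proper: "\<one>\<^bsub>R\<^esub> \<notin> J"
    and maximal: "\<And>K. ideal K R \<Longrightarrow> J \<subset> K \<Longrightarrow> \<one>\<^bsub>R\<^esub> \<in> K"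
  shows "simple_ring (R Quot J)"
proof -
  interpret J: ideal J R by fact
  have zero_Quot: "\<zero>\<^bsub>R Quot J\<^esub> = J"
    by (simp add: FactRing_def)
  interpret h: ring_hom_ring R "R Quot J" "(+>\<^bsub>R\<^esub>) J" by (rule J.rcos_ring_hom_ring)
  have zero: "J +>\<^bsub>R\<^esub> x = \<zero>\<^bsub>R Quot J\<^esub> \<longleftrightarrow> x \<in> J" if "x \<in> carrier R" for x
    unfolding zero_Quot using J.a_rcos_const J.a_rcos_self[OF that] by metis
  have surj: "carrier (R Quot J) = (+>\<^bsub>R\<^esub>) J ` carrier R"
    unfolding FactRing_simps by auto
  have "I = {\<zero>\<^bsub>R Quot J\<^esub>} \<or> I = carrier (R Quot J)" if "ideal I (R Quot J)" for I
  proof -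
    interpret I: ideal I "R Quot J" by fact
    \<comment> \<open>The preimage of \<open>I\<close> under the projection; it contains
      \<open>J\<close>, and it equals \<open>J\<close> only if \<open>I\<close> is zero.\<close>
    define K where "K = {x \<in> carrier R. J +>\<^bsub>R\<^esub> x \<in> I}"
    have K: "ideal K R"
      unfolding K_def by (rule h.ideal_vimage[OF that])
    have zero_in: "\<zero>\<^bsub>R Quot J\<^esub> \<in> I"
      by (rule additive_subgroup.zero_closed[OF I.additive_subgroup_axioms])
    have "J \<subseteq> K"
    proof
      fix x assume "x \<in> J"
      then show "x \<in> K"
        using zero[OF J.Icarr] zero_in J.Icarr unfolding K_def by (metis (mono_tags) mem_Collect_eq)
    qed
    show ?thesis
    proof (cases "K = J")
      case True
      then have "I \<subseteq> {\<zero>\<^bsub>R Quot J\<^esub>}"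
        using I.Icarr zero by (fastforce simp: K_def surj)
      then show ?thesis
        using zero_in by blast
    next
      case False
      then have "\<one>\<^bsub>R\<^esub> \<in> K"
        using maximal[OF K] \<open>J \<subseteq> K\<close> by blast
      then have "\<one>\<^bsub>R Quot J\<^esub> \<in> I"
        by (simp add: K_def)
      then show ?thesis
        using I.one_imp_carrier by blast
    qed
  qed
  moreover have "\<one>\<^bsub>R Quot J\<^esub> \<noteq> \<zero>\<^bsub>R Quot J\<^esub>"
    using zero[of "\<one>\<^bsub>R\<^esub>"] proper by simp
  ultimately show ?thesis
    unfolding simple_ring_def using h.S.one_closed h.S.ring_axioms by blast
qed

theorem proposition5p4:
  assumes "CARD('n) \<ge> 2"
  shows "simple_ring (leavitt :: (('n::finite, 'k::field) leavitt_gen, 'k) free_algebra set ring)"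
proof -
  interpret R: ring "ring_of_type_algebra :: (('n, 'k) leavitt_gen, 'k) free_algebra ring"
    by (rule ring_ring_of_type_algebra)
  let ?J = "Idl\<^bsub>ring_of_type_algebra\<^esub> leavitt_relations :: (('n, 'k) leavitt_gen, 'k) free_algebra set"
  interpret leavitt_ideal ?J
    by (intro leavitt_ideal.intro R.genideal_ideal R.genideal_self) auto
  \<comment> \<open>The generated ideal is the least one containing the relations, so a proper ideal
    containing them shows that the quotient is nonzero.\<close>
  have "?J \<subseteq> high_order_annihilator"
    by (intro R.genideal_minimal ideal_high_order_annihilator leavitt_relations_high_order_annihilator)
  then have "1 \<notin> ?J"
    using one_notin_high_order_annihilator by blast
  then show ?thesis
    unfolding leavitt_def using one_in_larger_ideal
    by (intro simple_ring_quotient ideal) (auto simp: psubset_eq)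
qed

end
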